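(* Let $n\ge1$. If $\varphi\in\mathrm{BMO}^d(\mathbb{R}^n)$, then for any $J\in\mathcal{D}$, $$ \frac{2^{n/2}}{2^n+1}\,\Delta_{2,J}(\varphi)\le\|\varphi\|_{\mathrm{BMO}^d(\mathbb{R}^n)}\,\Delta_{1,J}(\varphi). $$ This inequality is sharp for every value of $\|\varphi\|_{\mathrm{BMO}^d(\mathbb{R}^n)}$; that is, for every $\varepsilon>0$, the constant $\frac{2^{n/2}}{2^n+1}$ cannot be replaced by a larger one even if the inequality is only required for functions $\varphi$ with $\|\varphi\|_{\mathrm{BMO}^d(\mathbb{R}^n)}=\varepsilon$ (and all $J\in\mathcal{D}$). Consequently, $$ \frac{2^{n/2}}{2^n+1}\,\|\varphi\|_{\mathrm{BMO}^d(\mathbb{R}^n)}\le\|\varphi\|_{\mathrm{BMO}^{d,1}(\mathbb{R}^n)}. $$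
   Context: $\mathcal{D}$ is the collection of all open dyadic cubes in $\mathbb{R}^n$ (the standard dyadic lattice, determined by the root cube $(0,1)^n$). $\langle\varphi\rangle_J=\frac1{|J|}\int_J\varphi$ (Lebesgue measure), and $\Delta_{p,J}(\varphi)=\langle|\varphi-\langle\varphi\rangle_J|^p\rangle_J$ for $p>0$. For real $\varphi\in L^1_{loc}(\mathbb{R}^n)$, $$\|\varphi\|_{\mathrm{BMO}^d(\mathbb{R}^n)}=\sup_{J\in\mathcal{D}}\big(\Delta_{2,J}(\varphi)\big)^{1/2},\qquad \|\varphi\|_{\mathrm{BMO}^{d,1}(\mathbb{R}^n)}=\sup_{J\in\mathcal{D}}\Delta_{1,J}(\varphi),$$ and $\mathrm{BMO}^d(\mathbb{R}^n)$ is the set of $\varphi\in L^1_{loc}(\mathbb{R}^n)$ with $\|\varphi\|_{\mathrm{BMO}^d(\mathbb{R}^n)}<\infty$. *)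

theory Defs
  imports "HOL-Analysis.Analysis"
begin

definition dyadic_cubes :: "(real ^ 'n) set set" where
  "dyadic_cubes =
     {box (\<chi> i. 2 powi k * of_int (m $ i)) (\<chi> i. 2 powi k * (of_int (m $ i) + 1))
        | (k :: int) (m :: int ^ 'n). True}"

definition locally_integrable :: "(real ^ 'n \<Rightarrow> real) \<Rightarrow> bool" where
  "locally_integrable \<phi> \<longleftrightarrow> (\<forall>K. compact K \<longrightarrow> set_integrable lebesgue K \<phi>)"

definition average :: "(real ^ 'n) set \<Rightarrow> (real ^ 'n \<Rightarrow> real) \<Rightarrow> real" where
  "average J \<phi> = set_lebesgue_integral lebesgue J \<phi> / measure lebesgue J"

text \<open>The oscillation takes values in the extended nonnegative reals, since a locally
  integrable function need not be square integrable on a cube.\<close>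

definition Delta :: "real \<Rightarrow> (real ^ 'n) set \<Rightarrow> (real ^ 'n \<Rightarrow> real) \<Rightarrow> ennreal" where
  "Delta p J \<phi> =
     (\<integral>\<^sup>+x\<in>J. ennreal (\<bar>\<phi> x - average J \<phi>\<bar> powr p) \<partial>lebesgue) / emeasure lebesgue J"

definition esqrt :: "ennreal \<Rightarrow> ennreal" where
  "esqrt a = (if a = \<infinity> then \<infinity> else ennreal (sqrt (enn2real a)))"

definition BMOd_norm :: "(real ^ 'n \<Rightarrow> real) \<Rightarrow> ennreal" where
  "BMOd_norm \<phi> = (SUP J\<in>dyadic_cubes. esqrt (Delta 2 J \<phi>))"

definition BMOd1_norm :: "(real ^ 'n \<Rightarrow> real) \<Rightarrow> ennreal" where
  "BMOd1_norm \<phi> = (SUP J\<in>dyadic_cubes. Delta 1 J \<phi>)"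

definition BMOd :: "(real ^ 'n \<Rightarrow> real) set" where
  "BMOd = {\<phi>. locally_integrable \<phi> \<and> BMOd_norm \<phi> < \<infinity>}"

definition BMO_const :: "'n::finite itself \<Rightarrow> real" where
  "BMO_const _ = 2 powr (real CARD('n) / 2) / (2 ^ CARD('n) + 1)"

end

theory Submission
  imports Defs
begin

text \<open>
  Write \<open>N = 2\<^sup>n\<close>, \<open>c = sqrt N / (N + 1)\<close>, and normalise the norm of \<open>\<phi>\<close> to 1 and its mean
  over \<open>J\<close> to 0. To a dyadic cube attach the point \<open>(x, y)\<close> formed by the means of \<open>\<phi>\<close> and \<open>\<phi>\<^sup>2\<close>;
  it satisfies \<open>x\<^sup>2 \<le> y \<le> x\<^sup>2 + 1\<close>. The function \<open>B(x, y)\<close>, equal to \<open>max \<bar>x\<bar> (c y)\<close> for \<open>\<bar>x\<bar> < sqrt N\<close>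
  and to \<open>\<bar>x\<bar>\<close> otherwise, is dominated by its average when the point splits into the
  points of the \<open>N\<close> children. As \<open>B(x, y) \<le> \<bar>x\<bar> + c (y - x\<^sup>2)\<close>, and the variances \<open>y - x\<^sup>2\<close> average out
  to 0 along the generations, \<open>c y \<le> B(0, y)\<close> is at most the mean of \<open>\<bar>\<phi>\<bar>\<close>.

  Equality holds for the function that vanishes except on two third-generation descendants
  of \<open>J\<close> lying in different children, and that on these has mean \<open>sqrt N\<close> and \<open>- sqrt N\<close>,
  constant sign and variance 1. Each parent of such a cube again has variance exactly 1.
\<close>

section \<open>The Bellman function\<close>

text \<open>Both pieces of the function agree at \<open>x = 1 / sqrt N\<close>, \<open>y = x\<^sup>2 + 1\<close>, which is what determines \<open>c\<close>.
  If \<open>B A Y = c * Y\<close> and some \<open>\<bar>a j\<bar> \<ge> sqrt N\<close>, then already the average of the \<open>\<bar>a i\<bar>\<close> is at least \<open>c (A\<^sup>2 + 1)\<close>.\<close>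

lemma bellman_step:
  fixes a b :: "'i \<Rightarrow> real" and c N :: real
  defines "B \<equiv> \<lambda>x y. if \<bar>x\<bar> < sqrt N then max \<bar>x\<bar> (c * y) else \<bar>x\<bar>"
  assumes I: "finite I" "real (card I) = N" and N: "N > 1" and c: "c = sqrt N / (N + 1)"
    and A: "A = (\<Sum>i\<in>I. a i) / N" and Y: "Y = (\<Sum>i\<in>I. b i) / N"
    and var: "Y \<le> A\<^sup>2 + 1"
  shows "B A Y \<le> (\<Sum>i\<in>I. B (a i) (b i)) / N"
proof -
  have c0: "c > 0" using N c by simp
  have ge: "\<bar>a i\<bar> \<le> B (a i) (b i)" for i by (auto simp: B_def)
  have "N * \<bar>A\<bar> \<le> (\<Sum>i\<in>I. \<bar>a i\<bar>)"
    using N unfolding A by (simp add: abs_divide sum_abs)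
  then have absA: "\<bar>A\<bar> \<le> (\<Sum>i\<in>I. B (a i) (b i)) / N"
    using sum_mono[of I "\<lambda>i. \<bar>a i\<bar>", OF ge] N
    by (simp add: field_simps)
  have "c * Y \<le> (\<Sum>i\<in>I. B (a i) (b i)) / N" if small: "\<bar>A\<bar> < sqrt N" "\<bar>A\<bar> < c * Y"
  proof (cases "\<forall>i\<in>I. \<bar>a i\<bar> < sqrt N")
    case True
    then have "(\<Sum>i\<in>I. c * b i) \<le> (\<Sum>i\<in>I. B (a i) (b i))"
      by (intro sum_mono) (auto simp: B_def)
    then show ?thesis
      using N by (simp add: Y sum_distrib_left divide_right_mono)
  next
    case False
    then obtain j where j: "j \<in> I" "\<bar>a j\<bar> \<ge> sqrt N" by force
    define s where "s = sqrt N"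
    have s: "s > 1" "s\<^sup>2 = N" using N by (auto simp: s_def)
    have cs: "c * (s\<^sup>2 + 1) = s" using c s N by (simp add: s_def field_simps)
    \<comment> \<open>Inserting \<open>Y <= A^2 + 1\<close> into \<open>|A| < c * Y\<close> gives a
      quadratic inequality in \<open>|A|\<close> with roots \<open>s\<close> and
      \<open>1 / s\<close>; as \<open>|A| < s\<close>, only \<open>|A| < 1 / s\<close> is
      left.\<close>
    have "(s\<^sup>2 + 1) * \<bar>A\<bar> < (s\<^sup>2 + 1) * (c * Y)"
      using small(2) s by (intro mult_strict_left_mono) (auto simp: add_pos_pos)
    also have "\<dots> = (c * (s\<^sup>2 + 1)) * Y" by (simp add: algebra_simps)
    also have "\<dots> = s * Y" by (simp only: cs)
    also have "\<dots> \<le> s * (A\<^sup>2 + 1)" using var s by simp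
    finally have "0 < (s - \<bar>A\<bar>) * (1 - s * \<bar>A\<bar>)"
      by (simp add: algebra_simps power2_eq_square flip: abs_mult)
    then have sA: "s * \<bar>A\<bar> < 1"
      using small(1) by (simp add: s_def zero_less_mult_iff)
    have NA: "(\<Sum>i\<in>I. a i) = N * A" using N by (simp add: A)
    have rest: "(\<Sum>i\<in>I - {j}. a i) = N * A - a j"
      using I(1) j(1) NA by (simp add: sum_diff1)
    \<comment> \<open>The other children have to compensate for \<open>a j\<close>: their values add
      up to \<open>N * A - a j\<close>, so the sum of all \<open>|a i|\<close> is at least
      \<open>2 * |a j| - N * |A|\<close>.\<close>
    have "\<bar>a j\<bar> + \<bar>N * A - a j\<bar> \<le> \<bar>a j\<bar> + (\<Sum>i\<in>I-{j}. \<bar>a i\<bar>)"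
      unfolding rest[symmetric] by (simp add: sum_abs)
    also have "\<dots> = (\<Sum>i\<in>I. \<bar>a i\<bar>)" using I(1) j(1) by (simp add: sum.remove)
    also have "\<dots> \<le> (\<Sum>i\<in>I. B (a i) (b i))" by (rule sum_mono[OF ge])
    finally have 1: "2 * s - N * \<bar>A\<bar> \<le> (\<Sum>i\<in>I. B (a i) (b i))"
      using j(2) N abs_triangle_ineq2[of "a j" "N * A"] by (simp add: s_def abs_mult abs_minus_commute)
    \<comment> \<open>The factor \<open>s^2 + 1\<close> removes \<open>c\<close>. In terms of
      \<open>t = s * |A|\<close> the claim becomes \<open>s^2 + t^2 <= (s^2 + 1) * (2 - t)\<close>,
      which holds because \<open>t^2 <= 1 <= 2 - t\<close>.\<close>
    have "(s\<^sup>2 + 1) * (c * N * (1 + A\<^sup>2)) = s * s\<^sup>2 * (1 + A\<^sup>2)"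
      using cs s(2) by (metis mult.assoc mult.commute)
    also have "\<dots> \<le> (s\<^sup>2 + 1) * (2 * s - s\<^sup>2 * \<bar>A\<bar>)"
    proof -
      define t where "t = s * \<bar>A\<bar>"
      have t: "0 \<le> t" "t < 1" using sA s by (auto simp: t_def)
      have At: "s\<^sup>2 * A\<^sup>2 = t\<^sup>2" "s\<^sup>2 * \<bar>A\<bar> = s * t" by (auto simp: t_def power_mult_distrib power2_eq_square)
      have "s * s\<^sup>2 * (1 + A\<^sup>2) = s * (s\<^sup>2 + t\<^sup>2)" using At by (simp add: algebra_simps)
      also have "\<dots> \<le> s * ((s\<^sup>2 + 1) * (2 - t))"
      proof (intro mult_left_mono)
        have "t\<^sup>2 \<le> 1" using t by (simp add: power_le_one)
        moreover have "(s\<^sup>2 + 1) * 1 \<le> (s\<^sup>2 + 1) * (2 - t)" using t by (intro mult_left_mono) auto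
        ultimately show "s\<^sup>2 + t\<^sup>2 \<le> (s\<^sup>2 + 1) * (2 - t)" by simp
      qed (use s in auto)
      also have "\<dots> = (s\<^sup>2 + 1) * (2 * s - s\<^sup>2 * \<bar>A\<bar>)" unfolding At by (simp add: algebra_simps)
      finally show ?thesis .
    qed
    finally have "c * N * (1 + A\<^sup>2) \<le> 2 * s - s\<^sup>2 * \<bar>A\<bar>"
      using N s(2) by (simp add: mult_le_cancel_left_pos)
    moreover have "c * N * Y \<le> c * N * (1 + A\<^sup>2)" using var c0 N by (intro mult_left_mono) auto
    ultimately have "c * N * Y \<le> (\<Sum>i\<in>I. B (a i) (b i))" using 1 s(2) by simp
    then show ?thesis using N by (simp add: field_simps)
  qed
  moreover have "B A Y = (if \<bar>A\<bar> < sqrt N \<and> \<bar>A\<bar> < c * Y then c * Y else \<bar>A\<bar>)"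
    by (auto simp: B_def max_def)
  ultimately show ?thesis using absA by simp
qed

section \<open>Dyadic cubes and means\<close>

text \<open>Unlike the open cubes, the half-open ones are exactly the disjoint union of their children.\<close>

definition dcube :: "int \<Rightarrow> int ^ 'n \<Rightarrow> (real ^ 'n) set" where
  "dcube k m = {x. \<forall>i. \<lfloor>x $ i / 2 powi k\<rfloor> = m $ i}"

abbreviation obox :: "int \<Rightarrow> int ^ 'n \<Rightarrow> (real ^ 'n) set" where
  "obox k m \<equiv> box (\<chi> i. 2 powi k * of_int (m $ i)) (\<chi> i. 2 powi k * (of_int (m $ i) + 1))"

abbreviation clbox :: "int \<Rightarrow> int ^ 'n \<Rightarrow> (real ^ 'n) set" where
  "clbox k m \<equiv> cbox (\<chi> i. 2 powi k * of_int (m $ i)) (\<chi> i. 2 powi k * (of_int (m $ i) + 1))"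

lemma mem_dcube:
  "x \<in> dcube k m \<longleftrightarrow> (\<forall>i. 2 powi k * of_int (m $ i) \<le> x $ i \<and> x $ i < 2 powi k * (of_int (m $ i) + 1))"
  by (simp add: dcube_def floor_eq_iff field_simps)

lemma obox_subset_dcube: "obox k m \<subseteq> dcube k m" and dcube_subset_clbox: "dcube k m \<subseteq> clbox k m"
  by (auto simp: mem_dcube mem_box_cart less_imp_le)

lemma negligible_dcube_diff: "negligible (dcube k m - obox k m)"
  by (rule negligible_subset[OF negligible_frontier_interval]) (use dcube_subset_clbox in blast)

text \<open>The bridge between the open cubes of the theorem and the half-open cubes used for
  subdivision: they differ only in faces, which are negligible.\<close>

lemma AE_obox_dcube: "AE x in lebesgue. x \<in> obox k m \<longleftrightarrow> x \<in> dcube k m"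
proof -
  have "AE x in lebesgue. x \<notin> dcube k m - obox k m"
    using negligible_dcube_diff[of k m] AE_not_in negligible_iff_null_sets by blast
  then show ?thesis by eventually_elim (use obox_subset_dcube in blast)
qed

lemma dcube_sets [measurable]: "dcube k m \<in> sets lebesgue"
proof -
  have "dcube k m = obox k m \<union> (dcube k m - obox k m)" using obox_subset_dcube by blast
  also have "\<dots> \<in> sets lebesgue"
    by (intro sets.Un) (auto intro: negligible_imp_sets negligible_dcube_diff)
  finally show ?thesis .
qed

lemma measure_obox: "measure lebesgue (obox k m :: (real ^ 'n) set) = (2 powi k) ^ CARD('n)"
proof -
  have ne: "clbox k m \<noteq> ({} :: (real ^ 'n) set)"
    by (simp add: interval_ne_empty_cart)
  have "measure lebesgue (obox k m :: (real ^ 'n) set) = measure lborel (clbox k m :: (real ^ 'n) set)"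
    by (simp add: measure_lborel_box_eq measure_lborel_cbox_eq del: measure_lborel_box measure_lborel_cbox)
  also have "\<dots> = (2 powi k) ^ CARD('n)"
    by (subst content_cbox_cart[OF ne]) (simp add: algebra_simps)
  finally show ?thesis .
qed

lemma measure_dcube: "measure lebesgue (dcube k m :: (real ^ 'n) set) = (2 powi k) ^ CARD('n)"
  unfolding measure_obox[of k m, symmetric]
  by (rule measure_eq_AE) (use AE_obox_dcube[of k m] in \<open>auto elim: eventually_mono\<close>)

lemma emeasure_dcube: "emeasure lebesgue (dcube k m :: (real ^ 'n) set) = ennreal ((2 powi k) ^ CARD('n))"
  and emeasure_obox: "emeasure lebesgue (obox k m :: (real ^ 'n) set) = ennreal ((2 powi k) ^ CARD('n))"
proof -
  have "emeasure lebesgue (obox k m :: (real ^ 'n) set) < \<infinity>"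
    by (simp add: emeasure_lborel_box_eq)
  then show o: "emeasure lebesgue (obox k m :: (real ^ 'n) set) = ennreal ((2 powi k) ^ CARD('n))"
    by (subst emeasure_eq_ennreal_measure) (auto simp del: emeasure_completion measure_completion simp: measure_obox less_top)
  show "emeasure lebesgue (dcube k m :: (real ^ 'n) set) = ennreal ((2 powi k) ^ CARD('n))"
    unfolding o[symmetric]
    by (rule emeasure_eq_AE) (use AE_obox_dcube[of k m] in \<open>auto elim: eventually_mono\<close>)
qed

text \<open>The set \<open>S\<close> lists the coordinates in which the upper half of the side is
  taken, so the children are indexed by a type with exactly \<open>2^n\<close> elements.\<close>

definition child :: "int ^ 'n \<Rightarrow> 'n set \<Rightarrow> int ^ 'n" where
  "child m S = (\<chi> i. 2 * m $ i + of_bool (i \<in> S))"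

lemma child_inject [simp]: "child m S = child m' S' \<longleftrightarrow> m = m' \<and> S = S'"
proof
  assume eq: "child m S = child m' S'"
  have "m $ i = m' $ i \<and> (i \<in> S \<longleftrightarrow> i \<in> S')" for i
  proof -
    have "2 * m $ i + of_bool (i \<in> S) = 2 * m' $ i + of_bool (i \<in> S')"
      using arg_cong[OF eq, of "\<lambda>v. v $ i"] by (simp add: child_def)
    then show ?thesis by (auto simp: of_bool_def split: if_splits) presburger+
  qed
  then show "m = m' \<and> S = S'" by (auto simp: vec_eq_iff)
qed simp

lemma dcube_disjoint: "x \<in> dcube k m \<Longrightarrow> x \<in> dcube k m' \<Longrightarrow> m = m'"
  by (simp add: dcube_def vec_eq_iff)

text \<open>The floor of \<open>2 * y\<close> is twice the floor of \<open>y\<close>, plus one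
  exactly when it is odd. The coordinates with odd floor therefore form the set \<open>S\<close> of
  the child that contains a given point.\<close>

lemma dcube_children: "dcube k (m :: int ^ 'n) = (\<Union>S. dcube (k - 1) (child m S))"
proof -
  have pk: "x / 2 powi (k - 1) = 2 * (x / 2 powi k)" for x :: real
    by (simp add: power_int_diff)
  have fl: "\<lfloor>2 * y\<rfloor> = 2 * \<lfloor>y\<rfloor> + of_bool (odd \<lfloor>2 * y\<rfloor>)" for y :: real
  proof -
    have "\<lfloor>2 * y\<rfloor> = 2 * \<lfloor>y\<rfloor> \<or> \<lfloor>2 * y\<rfloor> = 2 * \<lfloor>y\<rfloor> + 1" by linarith
    then show ?thesis by auto
  qed
  have fl2: "\<lfloor>y\<rfloor> = z" if "\<lfloor>2 * y\<rfloor> = 2 * z + of_bool b" for y :: real and z b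
    using that by (cases b; simp) linarith+
  show ?thesis
  proof safe
    fix x :: "real ^ 'n" assume x: "x \<in> dcube k m"
    have "\<lfloor>2 * (x $ i / 2 powi k)\<rfloor> = 2 * m $ i + of_bool (odd \<lfloor>2 * (x $ i / 2 powi k)\<rfloor>)" for i
      using fl[of "x $ i / 2 powi k"] x by (simp add: dcube_def del: times_divide_eq_right)
    then have "x \<in> dcube (k - 1) (child m {i. odd \<lfloor>2 * (x $ i / 2 powi k)\<rfloor>})"
      unfolding dcube_def pk child_def mem_Collect_eq vec_lambda_beta by blast
    then show "x \<in> (\<Union>S. dcube (k - 1) (child m S))" by blast
  next
    fix x :: "real ^ 'n" and S assume "x \<in> dcube (k - 1) (child m S)"
    then have "\<lfloor>2 * (x $ i / 2 powi k)\<rfloor> = 2 * m $ i + of_bool (i \<in> S)" for i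
      by (simp add: dcube_def pk child_def del: times_divide_eq_right)
    then show "x \<in> dcube k m"
      unfolding dcube_def mem_Collect_eq using fl2 by blast
  qed
qed

lemma card_children: "card (UNIV :: 'n::finite set set) = 2 ^ CARD('n)"
  by (simp add: card_Pow flip: Pow_UNIV)

section \<open>Means over dyadic cubes and averages over generations\<close>

definition mean :: "(real ^ 'n \<Rightarrow> real) \<Rightarrow> int \<Rightarrow> int ^ 'n \<Rightarrow> real" where
  "mean f k m = (LINT x:dcube k m|lebesgue. f x) / (2 powi k) ^ CARD('n)"

lemma set_integrable_child:
  fixes f :: "real ^ 'n \<Rightarrow> real"
  assumes "set_integrable lebesgue (dcube k m) f"
  shows "set_integrable lebesgue (dcube (k - 1) (child m S)) f"
  by (rule set_integrable_subset[OF assms dcube_sets]) (use dcube_children in blast)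

lemma mean_children:
  fixes f :: "real ^ 'n \<Rightarrow> real"
  assumes "set_integrable lebesgue (dcube k m) f"
  shows "mean f k m = (\<Sum>S\<in>UNIV. mean f (k - 1) (child m S)) / 2 ^ CARD('n)"
proof -
  have "(LINT x:dcube k m|lebesgue. f x) = (\<Sum>S\<in>UNIV. LINT x:dcube (k - 1) (child m S)|lebesgue. f x)"
    unfolding dcube_children[of k m]
    by (rule set_integral_finite_Union)
       (auto simp: disjoint_family_on_def dest: dcube_disjoint intro: set_integrable_child[OF assms])
  moreover have "(2 powi k) ^ CARD('n) = (2 ^ CARD('n) * (2 powi (k - 1)) ^ CARD('n) :: real)"
    by (simp add: power_int_diff power_divide)
  ultimately show ?thesis
    by (simp add: mean_def sum_divide_distrib mult.commute)
qed

text \<open>The average of a function of cubes over all descendants \<open>r\<close> generations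
  below. The recursion spares an index set for these descendants.\<close>

fun descendant_average :: "nat \<Rightarrow> (int \<Rightarrow> int ^ 'n \<Rightarrow> real) \<Rightarrow> int \<Rightarrow> int ^ 'n \<Rightarrow> real" where
  "descendant_average 0 F k m = F k m"
| "descendant_average (Suc r) F k m = (\<Sum>S\<in>UNIV. descendant_average r F (k - 1) (child m S)) / 2 ^ CARD('n)"

lemma descendant_average_add: "descendant_average r (\<lambda>k m. F k m + G k m) k m = descendant_average r F k m + descendant_average r G k m"
  by (induction r arbitrary: k m) (simp_all add: sum.distrib add_divide_distrib)

lemma descendant_average_cmult: "descendant_average r (\<lambda>k m. c * F k m) k m = c * descendant_average r F k m"
  by (induction r arbitrary: k m) (simp_all flip: sum_distrib_left)

lemma descendant_average_const: "descendant_average r (\<lambda>k m. c) k (m :: int ^ 'n) = c"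
  by (induction r arbitrary: k m) (simp_all add: card_children)

text \<open>The comparison is demanded only on the cubes that are really averaged, so estimates
  valid just for small cubes inside the given one can be inserted.\<close>

lemma descendant_average_mono:
  assumes "\<And>m'. dcube (k - int r) m' \<subseteq> dcube k m \<Longrightarrow> F (k - int r) m' \<le> G (k - int r) m'"
  shows "descendant_average r F k m \<le> descendant_average r G k m"
  using assms
proof (induction r arbitrary: k m)
  case (Suc r)
  have "descendant_average r F (k - 1) (child m S) \<le> descendant_average r G (k - 1) (child m S)" for S
  proof (rule Suc.IH)
    fix m' assume *: "dcube (k - 1 - int r) m' \<subseteq> dcube (k - 1) (child m S)"
    have **: "k - 1 - int r = k - int (Suc r)" by simp
    show "F (k - 1 - int r) m' \<le> G (k - 1 - int r) m'"
      unfolding ** by (rule Suc.prems) (use * in \<open>auto simp: dcube_children[of k m] **\<close>)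
  qed
  then show ?case by (simp add: sum_mono divide_right_mono)
qed (simp)

text \<open>Iteration of a one-generation inequality; it carries \<open>bellman_step\<close> down to
  arbitrarily small cubes.\<close>

lemma descendant_average_ge:
  assumes "\<And>k m. F k m \<le> (\<Sum>S\<in>UNIV. F (k - 1) (child m S)) / 2 ^ CARD('n)"
  shows "F k (m :: int ^ 'n) \<le> descendant_average r F k m"
proof (induction r arbitrary: k m)
  case (Suc r)
  have "F k m \<le> (\<Sum>S\<in>UNIV. F (k - 1) (child m S)) / 2 ^ CARD('n)" by (rule assms)
  also have "\<dots> \<le> descendant_average (Suc r) F k m"
    using Suc.IH by (simp add: sum_mono divide_right_mono)
  finally show ?case .
qed simp

lemma descendant_average_mean:
  assumes "set_integrable lebesgue (dcube k m) f"
  shows "descendant_average r (mean f) k m = mean f k m"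
  using assms
proof (induction r arbitrary: k m)
  case (Suc r)
  then show ?case by (simp add: set_integrable_child flip: mean_children)
qed simp

lemma set_integrable_const_dcube [simp]:
  "set_integrable lebesgue (dcube k m) (\<lambda>x. c :: real)"
  unfolding set_integrable_def
  by (intro integrable_scaleR_left integrable_real_indicator) (simp_all add: dcube_sets emeasure_dcube)

lemma mean_const [simp]: "mean (\<lambda>x. c) k m = c"
  unfolding mean_def by (subst set_integral_const) (simp_all add: dcube_sets measure_dcube emeasure_dcube)

lemma mean_add:
  assumes "set_integrable lebesgue (dcube k m) f" "set_integrable lebesgue (dcube k m) g"
  shows "mean (\<lambda>x. f x + g x) k m = mean f k m + mean g k m"
  using assms by (simp add: mean_def add_divide_distrib)

lemma mean_cmult: "mean (\<lambda>x. c * f x) k m = c * mean f k m"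
  by (simp add: mean_def)

lemma mean_mono:
  assumes "set_integrable lebesgue (dcube k m) f" "set_integrable lebesgue (dcube k m) g"
    and "\<And>x. x \<in> dcube k m \<Longrightarrow> f x \<le> g x"
  shows "mean f k m \<le> mean g k m"
  unfolding mean_def by (intro divide_right_mono set_integral_mono assms) auto

lemma mean_abs:
  assumes "set_integrable lebesgue (dcube k m) f"
  shows "\<bar>mean f k m\<bar> \<le> mean (\<lambda>x. \<bar>f x\<bar>) k m"
proof -
  have "mean f k m \<le> mean (\<lambda>x. \<bar>f x\<bar>) k m"
    by (rule mean_mono) (use assms set_integrable_abs in auto)
  moreover have "mean (\<lambda>x. -1 * f x) k m \<le> mean (\<lambda>x. \<bar>f x\<bar>) k m"
    by (intro mean_mono set_integrable_abs set_integrable_mult_right assms) simp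
  ultimately show ?thesis by (simp only: mean_cmult)
qed

section \<open>Local square integrability and variances\<close>

definition locally_L2 :: "(real ^ 'n \<Rightarrow> real) \<Rightarrow> bool" where
  "locally_L2 f \<longleftrightarrow> (\<forall>k m. set_integrable lebesgue (dcube k m) f \<and>
                     set_integrable lebesgue (dcube k m) (\<lambda>x. (f x)\<^sup>2))"

definition var :: "(real ^ 'n \<Rightarrow> real) \<Rightarrow> int \<Rightarrow> int ^ 'n \<Rightarrow> real" where
  "var f k m = mean (\<lambda>x. (f x)\<^sup>2) k m - (mean f k m)\<^sup>2"

lemma locally_L2D: "locally_L2 f \<Longrightarrow> set_integrable lebesgue (dcube k m) f"
  "locally_L2 f \<Longrightarrow> set_integrable lebesgue (dcube k m) (\<lambda>x. (f x)\<^sup>2)"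
  by (auto simp: locally_L2_def)

lemma set_integrable_square_diff:
  fixes f g :: "'a \<Rightarrow> real"
  assumes "set_integrable M A f" "set_integrable M A g"
    and sq: "set_integrable M A (\<lambda>x. (f x)\<^sup>2)" "set_integrable M A (\<lambda>x. (g x)\<^sup>2)"
  shows "set_integrable M A (\<lambda>x. (f x - g x)\<^sup>2)"
proof (rule set_integrable_bound)
  show "set_integrable M A (\<lambda>x. 2 * (f x)\<^sup>2 + 2 * (g x)\<^sup>2)"
    using sq by (intro set_integral_add) auto
  \<comment> \<open>Set integrability gives measurability only after multiplication by the
    indicator, hence the detour through the products.\<close>
  have "(\<lambda>x. (indicator A x *\<^sub>R f x - indicator A x *\<^sub>R g x)\<^sup>2) \<in> borel_measurable M"
    using assms(1,2) unfolding set_integrable_def by (intro borel_measurable_power borel_measurable_diff) auto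
  also have "(\<lambda>x. (indicator A x *\<^sub>R f x - indicator A x *\<^sub>R g x)\<^sup>2) = (\<lambda>x. indicator A x *\<^sub>R (f x - g x)\<^sup>2)"
    by (auto simp: indicator_def)
  finally show "set_borel_measurable M A (\<lambda>x. (f x - g x)\<^sup>2)"
    by (simp add: set_borel_measurable_def)
  have "(f x - g x)\<^sup>2 \<le> 2 * (f x)\<^sup>2 + 2 * (g x)\<^sup>2" for x
    using zero_le_power2[of "f x + g x"] unfolding power2_sum power2_diff by linarith
  then show "AE x in M. x \<in> A \<longrightarrow> norm ((f x - g x)\<^sup>2) \<le> norm (2 * (f x)\<^sup>2 + 2 * (g x)\<^sup>2)"
    by (auto simp: abs_of_nonneg)
qed

text \<open>Expansion of the square. It exhibits \<open>var\<close> as the least mean square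
  deviation from a constant, which yields its nonnegativity, its scaling and its upper
  bounds.\<close>

lemma mean_square_diff_const:
  assumes "locally_L2 f"
  shows "mean (\<lambda>x. (f x - c)\<^sup>2) k m = var f k m + (mean f k m - c)\<^sup>2"
proof -
  have "(\<lambda>x. (f x - c)\<^sup>2) = (\<lambda>x. (f x)\<^sup>2 + ((-2 * c) * f x + c\<^sup>2))"
    by (auto simp: power2_diff algebra_simps)
  then have "mean (\<lambda>x. (f x - c)\<^sup>2) k m = mean (\<lambda>x. (f x)\<^sup>2) k m + (-2 * c * mean f k m + c\<^sup>2)"
    using locally_L2D[OF assms, of k m]
    by (simp only: mean_add mean_cmult mean_const set_integral_add set_integrable_mult_right set_integrable_const_dcube)
  then show ?thesis by (simp add: var_def power2_diff algebra_simps)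
qed

lemma mean_nonneg:
  assumes "\<And>x. 0 \<le> f x"
  shows "0 \<le> mean f k m"
  unfolding mean_def set_lebesgue_integral_def
  by (intro divide_nonneg_nonneg integral_nonneg) (use assms in auto)

lemma var_nonneg: "locally_L2 f \<Longrightarrow> 0 \<le> var f k m"
  using mean_square_diff_const[of f "mean f k m" k m] mean_nonneg[of "\<lambda>x. (f x - mean f k m)\<^sup>2" k m]
  by simp

section \<open>Approximation by continuous functions and decay of the variances\<close>

lemma locally_L2_continuous:
  assumes "continuous_on UNIV g"
  shows "locally_L2 g"
proof -
  have "set_integrable lebesgue (dcube k m) h" if "continuous_on UNIV h" for k m and h :: "real ^ 'n \<Rightarrow> real"
    by (rule set_integrable_subset[OF absolutely_integrable_continuous[OF continuous_on_subset[OF that]] dcube_sets dcube_subset_clbox]) simp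
  then show ?thesis
    using assms by (auto simp: locally_L2_def intro!: continuous_on_power)
qed

text \<open>Truncation at a large height \<open>M\<close> changes \<open>f\<close> little in mean
  square. The truncated function is an almost everywhere limit of equally truncated continuous
  functions, and now a constant dominates.\<close>

lemma continuous_L2_dense:
  fixes f :: "'a :: euclidean_space \<Rightarrow> real"
  assumes D [measurable]: "D \<in> sets lebesgue" "emeasure lebesgue D < \<infinity>"
    and f1: "set_integrable lebesgue D f" and f2: "set_integrable lebesgue D (\<lambda>x. (f x)\<^sup>2)"
    and e: "e > 0"
  obtains g where "continuous_on UNIV g" "(LINT x:D|lebesgue. (f x - g x)\<^sup>2) < e"
proof -
  define F where "F = (\<lambda>x. indicator D x * f x)"
  have F [measurable]: "F \<in> borel_measurable lebesgue"
    using f1 by (simp add: set_integrable_def F_def)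
  define cl where "cl M t = max (- M) (min M t)" for M t :: real
  have cl_meas [measurable]: "cl M \<in> borel_measurable borel" for M by (simp add: cl_def[abs_def])
  obtain N h where N: "negligible N" and h: "\<And>n. continuous_on UNIV (h n :: 'a \<Rightarrow> real)"
      and lim: "\<And>x. x \<notin> N \<Longrightarrow> (\<lambda>n. h n x) \<longlonglongrightarrow> F x"
    using lebesgue_measurable_imp_measurable_on[OF F, of UNIV] by (auto simp: measurable_on_def)
  have h_meas [measurable]: "h n \<in> borel_measurable lebesgue" for n
    using h by (simp add: borel_measurable_continuous_onI measurable_completion)
  have dom1: "integrable lebesgue (\<lambda>x. indicator D x * (f x)\<^sup>2)"
    using f2 by (simp add: set_integrable_def)
  have dom2: "integrable lebesgue (\<lambda>x. indicator D x * c)" for c :: real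
    using D by (simp add: integrable_real_indicator)
  have le1: "\<bar>indicator D x * (F x - cl (real M) (F x))\<^sup>2\<bar> \<le> indicator D x * (f x)\<^sup>2" for M x
    by (auto simp: indicator_def F_def cl_def intro!: abs_le_square_iff[THEN iffD1])
  have I1: "integrable lebesgue (\<lambda>x. indicator D x * (F x - cl (real M) (F x))\<^sup>2)" for M
    by (rule Bochner_Integration.integrable_bound[OF dom1]) (use le1 in auto)
  have "(\<lambda>M. integral\<^sup>L lebesgue (\<lambda>x. indicator D x * (F x - cl (real M) (F x))\<^sup>2))
      \<longlonglongrightarrow> integral\<^sup>L lebesgue (\<lambda>x::'a. 0)"
  proof (rule integral_dominated_convergence[OF _ _ dom1])
    have "(\<lambda>M. indicator D x * (F x - cl (real M) (F x))\<^sup>2) \<longlonglongrightarrow> 0" for x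
    proof (rule tendsto_eventually)
      show "\<forall>\<^sub>F M in sequentially. indicator D x * (F x - cl (real M) (F x))\<^sup>2 = 0"
        using eventually_ge_at_top[of "nat \<lceil>\<bar>F x\<bar>\<rceil>"]
        by eventually_elim (auto simp: cl_def max_def min_def nat_le_iff ceiling_le_iff)
    qed
    then show "AE x in lebesgue. (\<lambda>M. indicator D x * (F x - cl (real M) (F x))\<^sup>2) \<longlonglongrightarrow> 0" by simp
  qed (use le1 in auto)
  \<comment> \<open>Each of the two errors gets \<open>e / 4\<close>, because the square of their
    sum costs a factor 2 on each.\<close>
  then have "\<forall>\<^sub>F M in sequentially. integral\<^sup>L lebesgue (\<lambda>x. indicator D x * (F x - cl (real M) (F x))\<^sup>2) < e / 4"
    using e by (auto intro!: order_tendstoD)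
  then obtain M :: nat where M: "integral\<^sup>L lebesgue (\<lambda>x. indicator D x * (F x - cl (real M) (F x))\<^sup>2) < e / 4"
    by (auto simp: eventually_sequentially)
  have "\<bar>cl (real M) s - cl (real M) t\<bar> \<le> \<bar>2 * real M\<bar>" for s t
    by (simp add: cl_def)
  then have "(cl (real M) s - cl (real M) t)\<^sup>2 \<le> (2 * real M)\<^sup>2" for s t
    by (rule abs_le_square_iff[THEN iffD1])
  then have le2: "\<bar>indicator D x * (cl (real M) (F x) - cl (real M) (h n x))\<^sup>2\<bar> \<le> indicator D x * (2 * real M)\<^sup>2" for n x
    by (simp add: abs_mult mult_left_mono)
  have I2: "integrable lebesgue (\<lambda>x. indicator D x * (cl (real M) (F x) - cl (real M) (h n x))\<^sup>2)" for n
    by (rule Bochner_Integration.integrable_bound[OF dom2[of "(2 * real M)\<^sup>2"]])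
       (use le2 in \<open>auto intro: order_trans[OF _ abs_ge_self]\<close>)
  have "(\<lambda>n. integral\<^sup>L lebesgue (\<lambda>x. indicator D x * (cl (real M) (F x) - cl (real M) (h n x))\<^sup>2))
      \<longlonglongrightarrow> integral\<^sup>L lebesgue (\<lambda>x::'a. 0)"
  proof (rule integral_dominated_convergence[OF _ _ dom2[of "(2 * real M)\<^sup>2"]])
    have "(\<lambda>n. indicator D x * (cl (real M) (F x) - cl (real M) (h n x))\<^sup>2) \<longlonglongrightarrow>
        indicator D x * (cl (real M) (F x) - cl (real M) (F x))\<^sup>2" if "x \<notin> N" for x
      unfolding cl_def by (intro tendsto_intros lim that)
    moreover have "AE x in lebesgue. x \<notin> N"
      using N AE_not_in negligible_iff_null_sets by blast
    ultimately show "AE x in lebesgue. (\<lambda>n. indicator D x * (cl (real M) (F x) - cl (real M) (h n x))\<^sup>2) \<longlonglongrightarrow> 0"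
      by (auto elim: eventually_mono)
  qed (use le2 in auto)
  then have "\<forall>\<^sub>F n in sequentially. integral\<^sup>L lebesgue (\<lambda>x. indicator D x * (cl (real M) (F x) - cl (real M) (h n x))\<^sup>2) < e / 4"
    using e by (auto intro!: order_tendstoD)
  then obtain n where n: "integral\<^sup>L lebesgue (\<lambda>x. indicator D x * (cl (real M) (F x) - cl (real M) (h n x))\<^sup>2) < e / 4"
    by (auto simp: eventually_sequentially)
  define g where "g x = cl (real M) (h n x)" for x
  have cg: "continuous_on UNIV g"
    unfolding g_def cl_def by (intro continuous_intros h)
  have "(LINT x:D|lebesgue. (f x - g x)\<^sup>2) \<le>
      integral\<^sup>L lebesgue (\<lambda>x. 2 * (indicator D x * (F x - cl (real M) (F x))\<^sup>2) + 2 * (indicator D x * (cl (real M) (F x) - cl (real M) (h n x))\<^sup>2))"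
    unfolding set_lebesgue_integral_def
  proof (rule integral_mono')
    fix x
    have "(s - u)\<^sup>2 \<le> 2 * (s - t)\<^sup>2 + 2 * (t - u)\<^sup>2" for s t u :: real
      using zero_le_power2[of "s - 2 * t + u"] by (simp add: power2_eq_square algebra_simps)
    from this[of "f x" "g x" "cl (real M) (F x)"]
    show "indicator D x *\<^sub>R (f x - g x)\<^sup>2 \<le>
        2 * (indicator D x * (F x - cl (real M) (F x))\<^sup>2) + 2 * (indicator D x * (cl (real M) (F x) - cl (real M) (h n x))\<^sup>2)"
      by (cases "x \<in> D") (simp_all add: F_def g_def)
  qed (use I1 I2 in auto)
  also have "\<dots> < e" using M n I1 I2 by simp
  finally show ?thesis using that[OF cg] by blast
qed

lemma dist_dcube:
  assumes "x \<in> dcube k m" "y \<in> dcube k (m :: int ^ 'n)"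
  shows "dist x y \<le> real CARD('n) * 2 powi k"
proof -
  have "dist x y \<le> (\<Sum>i\<in>UNIV. \<bar>x $ i - y $ i\<bar>)"
    using norm_le_l1_cart[of "x - y"] by (simp add: dist_norm)
  also have "\<dots> \<le> (\<Sum>i\<in>(UNIV :: 'n set). 2 powi k)"
  proof (rule sum_mono)
    fix i
    have "2 powi k * of_int (m $ i) \<le> x $ i" "x $ i < 2 powi k * (of_int (m $ i) + 1)"
      "2 powi k * of_int (m $ i) \<le> y $ i" "y $ i < 2 powi k * (of_int (m $ i) + 1)"
      using assms by (auto simp: mem_dcube)
    then show "\<bar>x $ i - y $ i\<bar> \<le> 2 powi k" by (simp add: distrib_left abs_le_iff)
  qed
  finally show ?thesis by simp
qed

lemma dcube_nonempty: "\<exists>x. x \<in> dcube k m"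
  by (rule exI[of _ "\<chi> i. 2 powi k * of_int (m $ i)"]) (simp add: mem_dcube)

lemma descendant_average_nonneg: "(\<And>k m. 0 \<le> F k m) \<Longrightarrow> 0 \<le> descendant_average r F k m"
  by (induction r arbitrary: k m) (auto intro!: sum_nonneg divide_nonneg_nonneg)

text \<open>For a continuous approximation \<open>g\<close>, the variance of \<open>f\<close> on a
  small cube is at most twice the mean of \<open>(f - g)^2\<close> plus twice the squared
  oscillation of \<open>g\<close>. Averaging leaves the first term equal to its value on the root,
  and uniform continuity makes the second small.\<close>

lemma descendant_average_var_tendsto:
  fixes f :: "real ^ 'n \<Rightarrow> real"
  assumes f: "locally_L2 f"
  shows "(\<lambda>r. descendant_average r (var f) k m) \<longlonglongrightarrow> 0"
proof (rule LIMSEQ_I)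
  fix e :: real assume e: "e > 0"
  \<comment> \<open>The final bound is below \<open>2 * w + 2 * w\<close>, which is
    \<open>e / 2\<close>.\<close>
  define w where "w = e / 8"
  have w: "w > 0" using e by (simp add: w_def)
  have vol: "0 < ((2 powi k) ^ CARD('n) :: real)" by simp
  obtain g where g: "continuous_on UNIV g"
    and "(LINT x:dcube k m|lebesgue. (f x - g x)\<^sup>2) < w * (2 powi k) ^ CARD('n)"
    using continuous_L2_dense[OF dcube_sets[of k m] _ locally_L2D[OF f, of k m], of "w * (2 powi k) ^ CARD('n)"] w vol
    by (auto simp: emeasure_dcube)
  then have close: "mean (\<lambda>x. (f x - g x)\<^sup>2) k m < w"
    using vol by (simp add: mean_def divide_less_eq)
  have int: "set_integrable lebesgue (dcube k' m') (\<lambda>x. (f x - g x)\<^sup>2)" for k' m'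
    by (intro set_integrable_square_diff locally_L2D f locally_L2_continuous g)
  have "uniformly_continuous_on (clbox k m) g"
    by (intro compact_uniformly_continuous continuous_on_subset[OF g]) auto
  then obtain d where d: "d > 0"
    and ud: "\<And>x y. x \<in> clbox k m \<Longrightarrow> y \<in> clbox k m \<Longrightarrow> dist y x < d \<Longrightarrow> dist (g y) (g x) < sqrt w"
    using w unfolding uniformly_continuous_on_def by (metis real_sqrt_gt_0_iff)
  have "(\<lambda>r. (real CARD('n) * 2 powi k) * (1 / 2) ^ r) \<longlonglongrightarrow> (real CARD('n) * 2 powi k) * 0"
    by (intro tendsto_intros) auto
  then have "\<forall>\<^sub>F r in sequentially. (real CARD('n) * 2 powi k) * (1 / 2) ^ r < d"
    using d by (intro order_tendstoD) auto
  then obtain r0 where r0: "\<And>r. r \<ge> r0 \<Longrightarrow> (real CARD('n) * 2 powi k) * (1 / 2) ^ r < d"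
    by (auto simp: eventually_sequentially)
  have "norm (descendant_average r (var f) k m - 0) < e" if r: "r \<ge> r0" for r
  proof -
    have small: "real CARD('n) * 2 powi (k - int r) < d"
      using r0[OF r] by (simp add: power_int_diff power_one_over)
    have "descendant_average r (var f) k m \<le> descendant_average r (\<lambda>k m. 2 * mean (\<lambda>x. (f x - g x)\<^sup>2) k m + 2 * w) k m"
    proof (rule descendant_average_mono)
      fix m' assume sub: "dcube (k - int r) m' \<subseteq> dcube k m"
      obtain y where y: "y \<in> dcube (k - int r) m'" using dcube_nonempty by blast
      \<comment> \<open>The value of \<open>g\<close> at any point of the small cube serves as the
        constant, since the variance is the least mean square deviation.\<close>
      have "var f (k - int r) m' \<le> mean (\<lambda>x. (f x - g y)\<^sup>2) (k - int r) m'"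
        by (simp add: mean_square_diff_const[OF f])
      also have "\<dots> \<le> mean (\<lambda>x. 2 * (f x - g x)\<^sup>2 + 2 * w) (k - int r) m'"
      proof (rule mean_mono)
        fix x assume x: "x \<in> dcube (k - int r) m'"
        have "dist (g x) (g y) < sqrt w"
          using ud[of y x] x y sub dcube_subset_clbox[of k m] dist_dcube[OF x y] small by force
        then have "(g x - g y)\<^sup>2 \<le> w"
          using w by (metis dist_real_def less_imp_le real_sqrt_le_iff real_sqrt_abs)
        moreover have "(f x - g y)\<^sup>2 \<le> 2 * (f x - g x)\<^sup>2 + 2 * (g x - g y)\<^sup>2"
          using zero_le_power2[of "f x - 2 * g x + g y"] by (simp add: power2_eq_square algebra_simps)
        ultimately show "(f x - g y)\<^sup>2 \<le> 2 * (f x - g x)\<^sup>2 + 2 * w" by linarith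
      next
        show "set_integrable lebesgue (dcube (k - int r) m') (\<lambda>x. (f x - g y)\<^sup>2)"
          by (intro set_integrable_square_diff locally_L2D[OF f] set_integrable_const_dcube)
        show "set_integrable lebesgue (dcube (k - int r) m') (\<lambda>x. 2 * (f x - g x)\<^sup>2 + 2 * w)"
          by (intro set_integral_add set_integrable_mult_right int) auto
      qed
      also have "\<dots> = 2 * mean (\<lambda>x. (f x - g x)\<^sup>2) (k - int r) m' + 2 * w"
        using int by (simp add: mean_add mean_cmult)
      finally show "var f (k - int r) m' \<le> 2 * mean (\<lambda>x. (f x - g x)\<^sup>2) (k - int r) m' + 2 * w" .
    qed
    \<comment> \<open>Averaging the means over the descendants returns the mean over the root, so
      the bound no longer depends on \<open>r\<close>.\<close>
    also have "\<dots> = 2 * mean (\<lambda>x. (f x - g x)\<^sup>2) k m + 2 * w"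
      by (simp add: descendant_average_add descendant_average_cmult descendant_average_const descendant_average_mean int)
    also have "\<dots> < e" using close e by (simp add: w_def)
    finally show ?thesis
      using descendant_average_nonneg[of "var f" r k m] var_nonneg[OF f] by simp
  qed
  then show "\<exists>r0. \<forall>r\<ge>r0. norm (descendant_average r (var f) k m - 0) < e" by blast
qed

section \<open>The Bellman induction and its rescaling\<close>

lemma mean_square_le_mean_abs:
  fixes f :: "real ^ 'n \<Rightarrow> real"
  defines "N \<equiv> 2 ^ CARD('n) :: real"
  assumes f: "locally_L2 f" and var: "\<And>k m. var f k m \<le> 1" and mean0: "mean f k m = 0"
  shows "sqrt N / (N + 1) * mean (\<lambda>x. (f x)\<^sup>2) k m \<le> mean (\<lambda>x. \<bar>f x\<bar>) k m"
proof -
  define c where "c = sqrt N / (N + 1)"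
  define B where "B = (\<lambda>x y. if \<bar>x\<bar> < sqrt N then max \<bar>x\<bar> (c * y) else \<bar>x\<bar>)"
  define F where "F k m = B (mean f k m) (mean (\<lambda>x. (f x)\<^sup>2) k m)" for k m
  have N: "N > 1" by (simp add: N_def)
  have c0: "c > 0" using N by (simp add: c_def)
  have F_step: "F k m \<le> (\<Sum>S\<in>UNIV. F (k - 1) (child m S)) / 2 ^ CARD('n)" for k m
    unfolding F_def B_def N_def[symmetric]
    by (rule bellman_step)
       (use N var[of k m] in \<open>auto simp: card_children N_def c_def var_def mean_children locally_L2D[OF f]\<close>)
  \<comment> \<open>For \<open>|x| < sqrt N\<close>, the bound \<open>c * sqrt N <= 1\<close> gives
    \<open>c * x^2 <= |x|\<close>. Hence \<open>B\<close> exceeds \<open>|x|\<close> by at most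
    \<open>c\<close> times the variance, an error that disappears in the limit.\<close>
  have F_le: "F k m \<le> \<bar>mean f k m\<bar> + c * var f k m" for k m
  proof -
    have "c * (mean f k m)\<^sup>2 \<le> \<bar>mean f k m\<bar>" if "\<bar>mean f k m\<bar> < sqrt N"
    proof -
      have "c * \<bar>mean f k m\<bar> \<le> c * sqrt N" using that c0 by simp
      also have "\<dots> \<le> 1" using N by (simp add: c_def)
      finally have "c * \<bar>mean f k m\<bar> * \<bar>mean f k m\<bar> \<le> 1 * \<bar>mean f k m\<bar>"
        by (rule mult_right_mono) simp
      then show ?thesis by (simp add: power2_eq_square)
    qed
    then show ?thesis
      using mult_nonneg_nonneg[OF less_imp_le[OF c0] var_nonneg[OF f, of k m]]
      by (auto simp: F_def B_def var_def right_diff_distrib)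
  qed
  have *: "F k m \<le> mean (\<lambda>x. \<bar>f x\<bar>) k m + c * descendant_average r (var f) k m" for r
  proof -
    have "F k m \<le> descendant_average r F k m" by (rule descendant_average_ge[of F, OF F_step])
    also have "\<dots> \<le> descendant_average r (\<lambda>k m. mean (\<lambda>x. \<bar>f x\<bar>) k m + c * var f k m) k m"
      using F_le mean_abs[OF locally_L2D(1)[OF f]] by (intro descendant_average_mono) (meson add_right_mono order_trans)
    also have "\<dots> = mean (\<lambda>x. \<bar>f x\<bar>) k m + c * descendant_average r (var f) k m"
      by (simp add: descendant_average_add descendant_average_cmult descendant_average_mean set_integrable_abs locally_L2D[OF f])
    finally show ?thesis .
  qed
  have "(\<lambda>r. mean (\<lambda>x. \<bar>f x\<bar>) k m + c * descendant_average r (var f) k m) \<longlonglongrightarrow> mean (\<lambda>x. \<bar>f x\<bar>) k m + c * 0"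
    by (intro tendsto_intros descendant_average_var_tendsto f)
  then have "F k m \<le> mean (\<lambda>x. \<bar>f x\<bar>) k m"
    using * by (auto intro: LIMSEQ_le_const)
  \<comment> \<open>At mean 0 the first branch of \<open>B\<close> applies and dominates
    \<open>c\<close> times the mean square.\<close>
  then show ?thesis using N by (simp add: F_def B_def mean0 c_def)
qed

lemma locally_L2_affine:
  assumes "locally_L2 f"
  shows "locally_L2 (\<lambda>x. s * (f x - a))"
proof -
  have "set_integrable lebesgue (dcube k m) (\<lambda>x. s * (f x - a)) \<and>
      set_integrable lebesgue (dcube k m) (\<lambda>x. s\<^sup>2 * (f x - a)\<^sup>2)" for k m
    by (intro conjI set_integrable_mult_right set_integrable_square_diff set_integral_diff
        locally_L2D[OF assms] set_integrable_const_dcube)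
  then show ?thesis by (simp add: locally_L2_def power_mult_distrib)
qed

lemma var_affine:
  assumes "locally_L2 f"
  shows "mean (\<lambda>x. s * (f x - a)) k m = s * (mean f k m - a)"
    and "var (\<lambda>x. s * (f x - a)) k m = s\<^sup>2 * var f k m"
proof -
  show *: "mean (\<lambda>x. s * (f x - a)) k m = s * (mean f k m - a)"
    using mean_add[of k m f "\<lambda>x. - a"] locally_L2D[OF assms] by (simp add: mean_cmult)
  show "var (\<lambda>x. s * (f x - a)) k m = s\<^sup>2 * var f k m"
    unfolding var_def[of "\<lambda>x. s * (f x - a)"] * power_mult_distrib
    by (simp only: mean_cmult mean_square_diff_const[OF assms]) (simp add: algebra_simps)
qed

text \<open>The normalisation is undone by passing to \<open>(f - mean f k m) / e\<close>, which
  divides variances by \<open>e^2\<close> and the mean oscillation by \<open>e\<close>.\<close>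

lemma var_le_mean_oscillation:
  fixes f :: "real ^ 'n \<Rightarrow> real"
  defines "N \<equiv> 2 ^ CARD('n) :: real"
  assumes f: "locally_L2 f" and var: "\<And>k m. var f k m \<le> e\<^sup>2" and e: "e > 0"
  shows "sqrt N / (N + 1) * var f k m \<le> e * mean (\<lambda>x. \<bar>f x - mean f k m\<bar>) k m"
proof -
  define g where "g x = 1 / e * (f x - mean f k m)" for x
  have g: "locally_L2 g" unfolding g_def by (rule locally_L2_affine[OF f])
  have vg: "var g k' m' = var f k' m' / e\<^sup>2" for k' m'
    unfolding g_def var_affine[OF f] by (simp add: power_divide)
  have mg: "mean g k m = 0" unfolding g_def var_affine[OF f] by simp
  have "sqrt N / (N + 1) * mean (\<lambda>x. (g x)\<^sup>2) k m \<le> mean (\<lambda>x. \<bar>g x\<bar>) k m"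
    unfolding N_def using e var by (intro mean_square_le_mean_abs g mg) (simp add: vg)
  also have "mean (\<lambda>x. (g x)\<^sup>2) k m = var f k m / e\<^sup>2"
    using vg[of k m] mg by (simp add: var_def[of g])
  also have "mean (\<lambda>x. \<bar>g x\<bar>) k m = mean (\<lambda>x. 1 / e * \<bar>f x - mean f k m\<bar>) k m"
    using e by (simp add: g_def abs_mult abs_divide)
  also have "\<dots> = 1 / e * mean (\<lambda>x. \<bar>f x - mean f k m\<bar>) k m" by (rule mean_cmult)
  finally have "e\<^sup>2 * (sqrt N / (N + 1) * (var f k m / e\<^sup>2)) \<le> e\<^sup>2 * (1 / e * mean (\<lambda>x. \<bar>f x - mean f k m\<bar>) k m)"
    by (rule mult_left_mono) simp
  then show ?thesis using e by (simp add: power2_eq_square)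
qed

section \<open>Dyadic BMO\<close>

lemma obox_dyadic: "obox k m \<in> dyadic_cubes"
  by (auto simp: dyadic_cubes_def)

lemma dyadicE:
  assumes "J \<in> dyadic_cubes"
  obtains k m where "J = obox k m"
  using assms by (auto simp: dyadic_cubes_def)

lemma average_obox:
  assumes f: "set_integrable lebesgue (dcube k m) f"
  shows "average (obox k m) f = mean f k m"
proof -
  have "set_integrable lebesgue (obox k m) f"
    by (rule set_integrable_subset[OF f _ obox_subset_dcube]) auto
  then have "(LINT x:obox k m|lebesgue. f x) = (LINT x:dcube k m|lebesgue. f x)"
    using f AE_obox_dcube[of k m] unfolding set_lebesgue_integral_def set_integrable_def
    by (intro integral_cong_AE borel_measurable_integrable) (auto elim!: eventually_mono simp: indicator_def)
  then show ?thesis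
    by (simp add: average_def mean_def measure_obox del: measure_completion measure_lborel_box)
qed

text \<open>Turns the extended-valued averages in \<open>Delta\<close> into real means over
  half-open cubes.\<close>

lemma nn_mean_obox:
  fixes h :: "real ^ 'n \<Rightarrow> real"
  assumes h: "set_integrable lebesgue (dcube k m) h" "\<And>x. 0 \<le> h x"
  shows "(\<integral>\<^sup>+x\<in>obox k m. ennreal (h x) \<partial>lebesgue) / emeasure lebesgue (obox k m) = ennreal (mean h k m)"
proof -
  have "(\<integral>\<^sup>+x\<in>obox k m. ennreal (h x) \<partial>lebesgue) = (\<integral>\<^sup>+x. ennreal (indicator (dcube k m) x *\<^sub>R h x) \<partial>lebesgue)"
    using AE_obox_dcube[of k m]
    by (intro nn_integral_cong_AE) (auto elim!: eventually_mono simp: indicator_def)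
  also have "\<dots> = ennreal (LINT x:dcube k m|lebesgue. h x)"
    unfolding set_lebesgue_integral_def
    by (rule nn_integral_eq_integral) (use h in \<open>auto simp: set_integrable_def\<close>)
  finally have "(\<integral>\<^sup>+x\<in>obox k m. ennreal (h x) \<partial>lebesgue) = ennreal (LINT x:dcube k m|lebesgue. h x)" .
  moreover have "0 \<le> (LINT x:dcube k m|lebesgue. h x)"
    unfolding set_lebesgue_integral_def using h(2)
    by (intro Bochner_Integration.integral_nonneg) auto
  ultimately show ?thesis
    by (simp only: emeasure_obox mean_def) (simp add: divide_ennreal)
qed

lemma abs_powr_two: "\<bar>t :: real\<bar> powr 2 = t\<^sup>2"
  by (cases "t = 0") simp_all

lemma Delta_obox:
  assumes f: "locally_L2 f"
  shows "Delta 2 (obox k m) f = ennreal (var f k m)"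
    and "Delta 1 (obox k m) f = ennreal (mean (\<lambda>x. \<bar>f x - mean f k m\<bar>) k m)"
proof -
  have "set_integrable lebesgue (dcube k m) (\<lambda>x. (f x - mean f k m)\<^sup>2)"
    by (intro set_integrable_square_diff locally_L2D[OF f] set_integrable_const_dcube)
  from nn_mean_obox[OF this] show "Delta 2 (obox k m) f = ennreal (var f k m)"
    by (simp only: Delta_def average_obox[OF locally_L2D(1)[OF f]] abs_powr_two zero_le_power2
        mean_square_diff_const[OF f]) simp
  have "set_integrable lebesgue (dcube k m) (\<lambda>x. \<bar>f x - mean f k m\<bar>)"
    by (intro set_integrable_abs set_integral_diff locally_L2D[OF f] set_integrable_const_dcube)
  from nn_mean_obox[OF this]
  show "Delta 1 (obox k m) f = ennreal (mean (\<lambda>x. \<bar>f x - mean f k m\<bar>) k m)"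
    by (simp only: Delta_def average_obox[OF locally_L2D(1)[OF f]] powr_one abs_ge_zero)
qed

lemma esqrt_ennreal: "0 \<le> v \<Longrightarrow> esqrt (ennreal v) = ennreal (sqrt v)"
  by (simp add: esqrt_def)

text \<open>A finite norm makes the nonnegative integral of \<open>(f - a)^2\<close> finite on every
  cube, \<open>a\<close> being the mean there. Adding back \<open>2 * a * f - a^2\<close>, which is
  integrable, shows that \<open>f^2\<close> is integrable; then all oscillations become real
  variances.\<close>

lemma BMOdE:
  fixes f :: "real ^ 'n \<Rightarrow> real"
  assumes f: "f \<in> BMOd"
  obtains e where "0 \<le> e" "BMOd_norm f = ennreal e" "locally_L2 f" "\<And>k m. var f k m \<le> e\<^sup>2"
proof -
  have fin: "BMOd_norm f < \<infinity>" and loc: "locally_integrable f" using f by (auto simp: BMOd_def)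
  define e where "e = enn2real (BMOd_norm f)"
  have e: "0 \<le> e" "BMOd_norm f = ennreal e" using fin by (auto simp: e_def)
  have le: "esqrt (Delta 2 (obox k m) f) \<le> BMOd_norm f" for k m
    unfolding BMOd_norm_def by (rule SUP_upper[OF obox_dyadic])
  have int1: "set_integrable lebesgue (dcube k m) f" for k m
    using loc by (intro set_integrable_subset[OF _ dcube_sets dcube_subset_clbox]) (auto simp: locally_integrable_def)
  have int2: "set_integrable lebesgue (dcube k m) (\<lambda>x. (f x)\<^sup>2)" for k m
  proof -
    define a where "a = mean f k m"
    define h where "h x = (f x - a)\<^sup>2" for x
    have "Delta 2 (obox k m) f \<noteq> \<infinity>"
      using le[of k m] fin by (auto simp: esqrt_def top_unique split: if_splits)
    then have "(\<integral>\<^sup>+x\<in>obox k m. ennreal (h x) \<partial>lebesgue) / ennreal ((2 powi k) ^ CARD('n)) \<noteq> \<infinity>"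
      by (simp only: Delta_def average_obox[OF int1] abs_powr_two emeasure_obox a_def h_def
          not_False_eq_True)
    \<comment> \<open>An infinite integral would stay infinite after division by the finite
      volume.\<close>
    then have "(\<integral>\<^sup>+x\<in>obox k m. ennreal (h x) \<partial>lebesgue) \<noteq> \<infinity>"
      unfolding infinity_ennreal_def by (rule contrapos_nn) (simp add: ennreal_top_divide)
    also have "(\<integral>\<^sup>+x\<in>obox k m. ennreal (h x) \<partial>lebesgue) = (\<integral>\<^sup>+x. ennreal (norm (indicator (dcube k m) x *\<^sub>R h x)) \<partial>lebesgue)"
      using AE_obox_dcube[of k m]
      by (intro nn_integral_cong_AE) (auto elim!: eventually_mono simp: indicator_def h_def)
    finally have fin': "(\<integral>\<^sup>+x. ennreal (norm (indicator (dcube k m) x *\<^sub>R h x)) \<partial>lebesgue) < \<infinity>"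
      by (simp add: less_top)
    have "(\<lambda>x. (indicator (dcube k m) x *\<^sub>R f x - indicator (dcube k m) x *\<^sub>R a)\<^sup>2) \<in> borel_measurable lebesgue"
      using int1[of k m] set_integrable_const_dcube[of k m a] unfolding set_integrable_def
      by (intro borel_measurable_power borel_measurable_diff) auto
    also have "(\<lambda>x. (indicator (dcube k m) x *\<^sub>R f x - indicator (dcube k m) x *\<^sub>R a)\<^sup>2) = (\<lambda>x. indicator (dcube k m) x *\<^sub>R h x)"
      by (auto simp: indicator_def h_def)
    finally have "set_integrable lebesgue (dcube k m) h"
      unfolding set_integrable_def using fin' by (rule integrableI_bounded)
    then have "set_integrable lebesgue (dcube k m) (\<lambda>x. h x + (2 * a * f x - a\<^sup>2))"
      by (intro set_integral_add set_integral_diff set_integrable_mult_right int1 set_integrable_const_dcube)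
    also have "(\<lambda>x. h x + (2 * a * f x - a\<^sup>2)) = (\<lambda>x. (f x)\<^sup>2)"
      by (auto simp: h_def power2_diff)
    finally show ?thesis .
  qed
  have sq: "locally_L2 f" using int1 int2 by (simp add: locally_L2_def)
  have "var f k m \<le> e\<^sup>2" for k m
  proof -
    have "sqrt (var f k m) \<le> e"
      using le[of k m] e var_nonneg[OF sq] by (simp add: Delta_obox[OF sq] esqrt_ennreal)
    then show ?thesis using sqrt_le_D by blast
  qed
  with that e sq show ?thesis by blast
qed

lemma BMO_const_eq: "BMO_const TYPE('n::finite) = sqrt (2 ^ CARD('n)) / (2 ^ CARD('n) + 1)"
proof -
  have "2 powr (real CARD('n) / 2) = (2 powr real CARD('n)) powr (1 / 2)"
    by (simp add: powr_powr)
  also have "\<dots> = sqrt (2 ^ CARD('n))"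
    by (simp add: powr_half_sqrt powr_realpow)
  finally show ?thesis by (simp add: BMO_const_def)
qed

lemma BMO_const_pos: "0 < BMO_const TYPE('n::finite)"
  by (simp add: BMO_const_eq add_pos_pos)

lemma Delta_two_le_Delta_one:
  fixes f :: "real ^ 'n \<Rightarrow> real"
  assumes f: "f \<in> BMOd" and J: "J \<in> dyadic_cubes"
  shows "ennreal (BMO_const TYPE('n)) * Delta 2 J f \<le> BMOd_norm f * Delta 1 J f"
proof -
  obtain e where e: "0 \<le> e" "BMOd_norm f = ennreal e" "locally_L2 f" "\<And>k m. var f k m \<le> e\<^sup>2"
    using BMOdE[OF f] by blast
  obtain k m where J: "J = obox k m" using dyadicE[OF J] by blast
  have "BMO_const TYPE('n) * var f k m \<le> e * mean (\<lambda>x. \<bar>f x - mean f k m\<bar>) k m"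
  \<comment> \<open>Norm zero rules out rescaling by \<open>1 / e\<close>, but then the variance
    itself vanishes.\<close>
  proof (cases "e = 0")
    case True
    then show ?thesis using e(4)[of k m] var_nonneg[OF e(3), of k m] by simp
  next
    case False
    with var_le_mean_oscillation[OF e(3,4)] e(1) show ?thesis by (simp add: BMO_const_eq)
  qed
  moreover have "0 \<le> mean (\<lambda>x. \<bar>f x - mean f k m\<bar>) k m" by (rule mean_nonneg) simp
  ultimately show ?thesis
    using var_nonneg[OF e(3), of k m] e(1,2) BMO_const_pos[where 'n='n]
    by (simp add: J Delta_obox[OF e(3)] flip: ennreal_mult)
qed

text \<open>Taking suprema over the cubes gives \<open>c * e^2 <= e * d\<close> for the two norms
  \<open>e\<close> and \<open>d\<close>. As \<open>e\<close> is finite, it can be cancelled unless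
  it is 0; an infinite \<open>d\<close> is trivial.\<close>

lemma BMOd_norm_le_BMOd1_norm:
  fixes f :: "real ^ 'n \<Rightarrow> real"
  assumes f: "f \<in> BMOd"
  shows "ennreal (BMO_const TYPE('n)) * BMOd_norm f \<le> BMOd1_norm f"
proof (cases "BMOd1_norm f")
  case (real d)
  define c where "c = BMO_const TYPE('n)"
  have c: "c > 0" by (simp add: c_def BMO_const_pos)
  obtain e where e: "0 \<le> e" "BMOd_norm f = ennreal e" "locally_L2 f" "\<And>k m. var f k m \<le> e\<^sup>2"
    using BMOdE[OF f] by blast
  have "esqrt (Delta 2 J f) \<le> ennreal (sqrt (e * d / c))" if J: "J \<in> dyadic_cubes" for J
  proof -
    obtain k m where km: "J = obox k m" using dyadicE[OF J] by blast
    have "ennreal c * Delta 2 J f \<le> BMOd_norm f * Delta 1 J f"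
      unfolding c_def by (rule Delta_two_le_Delta_one[OF f J])
    also have "\<dots> \<le> BMOd_norm f * BMOd1_norm f"
      unfolding BMOd1_norm_def by (intro mult_left_mono SUP_upper J) auto
    finally have "c * var f k m \<le> e * d"
      using e real c var_nonneg[OF e(3), of k m]
      by (simp add: km Delta_obox[OF e(3)] flip: ennreal_mult)
    then have "var f k m \<le> e * d / c" using c by (simp add: field_simps)
    then show ?thesis
      using var_nonneg[OF e(3), of k m]
      by (simp add: km Delta_obox[OF e(3)] esqrt_ennreal ennreal_leI)
  qed
  then have "ennreal e \<le> ennreal (sqrt (e * d / c))"
    unfolding e(2)[symmetric] BMOd_norm_def by (rule SUP_least)
  then have "e \<le> sqrt (e * d / c)" using e c real by simp
  then have "e\<^sup>2 \<le> e * d / c"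
    using e c real by (simp add: real_le_rsqrt sqrt_ge_absD real_sqrt_ge_abs2)
  then have "c * e \<le> d"
    using e c real by (cases "e = 0") (simp_all add: power2_eq_square field_simps)
  then show ?thesis using e c real by (simp add: c_def flip: ennreal_mult)
qed simp

section \<open>Sharpness\<close>

lemma dcube_child_subset: "dcube (k - 1) (child m S) \<subseteq> dcube k m"
  using dcube_children by blast

lemma dcube_parent: "\<exists>p. dcube k m \<subseteq> dcube (k + 1) p"
proof -
  \<comment> \<open>Halving the index and recording the parities inverts
    \<open>child\<close>.\<close>
  have "m = child (\<chi> i. m $ i div 2) {i. odd (m $ i)}"
    by (auto simp: child_def vec_eq_iff of_bool_def)
  then show ?thesis
    using dcube_child_subset[of "k + 1" "\<chi> i. m $ i div 2"] by (metis add_diff_cancel_right')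
qed

lemma dcube_ancestor: "\<exists>p. dcube k m \<subseteq> dcube (k + int r) p"
proof (induction r)
  case (Suc r)
  then obtain p where p: "dcube k m \<subseteq> dcube (k + int r) p" by blast
  moreover obtain q where "dcube (k + int r) p \<subseteq> dcube (k + int r + 1) q"
    using dcube_parent by blast
  ultimately show ?case by (auto simp: algebra_simps)
qed auto

text \<open>The ancestor of the smaller cube at level \<open>k\<close> either is the larger cube or
  is disjoint from it.\<close>

lemma dcube_nested:
  assumes "j \<le> k"
  shows "dcube j p \<subseteq> dcube k m \<or> dcube j p \<inter> dcube k m = {}"
proof -
  obtain q where q: "dcube j p \<subseteq> dcube k q"
    using dcube_ancestor[of j p "nat (k - j)"] assms by auto
  show ?thesis
  proof (cases "q = m")
    case False
    then have "dcube k q \<inter> dcube k m = {}" using dcube_disjoint by blast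
    with q show ?thesis by blast
  qed (use q in simp)
qed

lemma mean_cong: "(\<And>x. x \<in> dcube k m \<Longrightarrow> f x = g x) \<Longrightarrow> mean f k m = mean g k m"
  unfolding mean_def using set_lebesgue_integral_cong[OF dcube_sets, of k m f g] by simp

lemma set_integrable_indicator_dcube:
  "set_integrable lebesgue (dcube k m) (indicator (dcube j p) :: _ \<Rightarrow> real)"
  by (rule set_integrable_bound[OF set_integrable_const_dcube[of k m 1]])
     (auto simp: set_borel_measurable_def indicator_def[abs_def] intro!: dcube_sets)

lemma mean_indicator_subset:
  fixes m :: "int ^ 'n"
  assumes "dcube j p \<subseteq> dcube k m"
  shows "mean (indicator (dcube j p)) k m = (2 powi j / 2 powi k) ^ CARD('n)"
proof -
  have "(LINT x:dcube k m|lebesgue. indicator (dcube j p) x) = integral\<^sup>L lebesgue (indicator (dcube j p) :: _ \<Rightarrow> real)"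
    unfolding set_lebesgue_integral_def
    by (rule Bochner_Integration.integral_cong) (use assms in \<open>auto simp: indicator_def\<close>)
  also have "\<dots> = (2 powi j) ^ CARD('n)"
    using measure_dcube[of j p] by (simp add: dcube_sets)
  finally show ?thesis by (simp add: mean_def power_divide)
qed

lemma mean_indicator_disjoint:
  assumes "dcube j p \<inter> dcube k m = {}"
  shows "mean (indicator (dcube j p)) k m = 0"
proof -
  have "mean (indicator (dcube j p)) k m = mean (\<lambda>x. 0) k m"
    by (rule mean_cong) (use assms in \<open>auto simp: indicator_def\<close>)
  then show ?thesis by simp
qed

text \<open>The root of the example is \<open>dcube 3 0\<close>; the cubes with corners \<open>0\<close> and \<open>(7, \<dots>, 7)\<close> lie in
  opposite children of it, hence in no common dyadic cube of level below 3.\<close>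

definition corner_fun :: "real \<Rightarrow> real \<Rightarrow> real \<Rightarrow> real \<Rightarrow> real ^ 'n \<Rightarrow> real" where
  "corner_fun p q r s x = p * indicator (dcube 0 0) x + q * indicator (dcube (-1) 0) x
     + r * indicator (dcube 0 (\<chi> i. 7)) x + s * indicator (dcube (-1) (\<chi> i. 14)) x"

lemma corner_cubes:
  "dcube (-1) 0 \<subseteq> dcube 0 (0 :: int ^ 'n)" "dcube (-1) (\<chi> i. 14) \<subseteq> dcube 0 (\<chi> i. 7 :: int ^ 'n)"
  "dcube 0 0 \<inter> dcube 0 (\<chi> i. 7 :: int ^ 'n) = {}"
proof -
  show "dcube (-1) 0 \<subseteq> dcube 0 (0 :: int ^ 'n)"
    using dcube_child_subset[of 0 "0 :: int ^ 'n" "{}"] by (simp add: child_def flip: zero_vec_def)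
  show "dcube (-1) (\<chi> i. 14) \<subseteq> dcube 0 (\<chi> i. 7 :: int ^ 'n)"
    using dcube_child_subset[of 0 "\<chi> i. 7 :: int ^ 'n" "{}"] by (simp add: child_def)
  have "(0 :: int ^ 'n) \<noteq> (\<chi> i. 7)" by (simp add: vec_eq_iff)
  then show "dcube 0 0 \<inter> dcube 0 (\<chi> i. 7 :: int ^ 'n) = {}"
    using dcube_disjoint by blast
qed

text \<open>Since the two nested pairs of cubes are disjoint, the family is closed under squares
  and, for coefficients of fixed sign, under absolute values. All means needed then come from the
  single formula \<open>mean_corner_fun\<close>.\<close>

lemma corner_fun_square: "(corner_fun p q r s x)\<^sup>2 = corner_fun (p\<^sup>2) (2 * p * q + q\<^sup>2) (r\<^sup>2) (2 * r * s + s\<^sup>2) x"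
  and corner_fun_abs: "0 \<le> p \<Longrightarrow> 0 \<le> q \<Longrightarrow> \<bar>corner_fun p q (- p) (- q) x\<bar> = corner_fun p q p q x"
proof -
  consider "x \<in> dcube 0 0" "x \<notin> dcube 0 (\<chi> i. 7)" "x \<notin> dcube (-1) (\<chi> i. 14)"
    | "x \<in> dcube 0 (\<chi> i. 7)" "x \<notin> dcube 0 0" "x \<notin> dcube (-1) 0"
    | "x \<notin> dcube 0 (\<chi> i. 7)" "x \<notin> dcube 0 0" "x \<notin> dcube (-1) 0" "x \<notin> dcube (-1) (\<chi> i. 14)"
    using corner_cubes by blast
  note 3 = this
  show "(corner_fun p q r s x)\<^sup>2 = corner_fun (p\<^sup>2) (2 * p * q + q\<^sup>2) (r\<^sup>2) (2 * r * s + s\<^sup>2) x"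
    by (cases rule: 3) (simp_all add: corner_fun_def indicator_def power2_sum)
  show "\<bar>corner_fun p q (- p) (- q) x\<bar> = corner_fun p q p q x" if "0 \<le> p" "0 \<le> q"
    using that by (cases rule: 3) (simp_all add: corner_fun_def indicator_def)
qed

lemma set_integrable_corner_fun: "set_integrable lebesgue (dcube k m) (corner_fun p q r s)"
  unfolding corner_fun_def[abs_def]
  by (intro set_integral_add set_integrable_mult_right set_integrable_indicator_dcube)

lemma locally_L2_corner_fun: "locally_L2 (corner_fun p q r s)"
  by (simp add: locally_L2_def corner_fun_square set_integrable_corner_fun)

text \<open>A cube of level at least 0 contains a unit corner cube or misses it, and the lower
  corner point, which belongs to the half-open unit cube, decides which.\<close>

lemma mean_corner_fun:
  fixes m :: "int ^ 'n"
  assumes k: "0 \<le> k"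
  defines "a \<equiv> of_bool (0 \<in> dcube k m)" and "b \<equiv> of_bool ((\<chi> i. 7) \<in> dcube k m)"
  shows "mean (corner_fun p q r s) k m = (a * (p + q / 2 ^ CARD('n)) + b * (r + s / 2 ^ CARD('n))) / (2 powi k) ^ CARD('n)"
proof -
  have *: "mean (indicator (dcube 0 u)) k m = of_bool (z \<in> dcube k m) / (2 powi k) ^ CARD('n)
     \<and> mean (indicator (dcube (-1) v)) k m = of_bool (z \<in> dcube k m) / (2 powi k) ^ CARD('n) / 2 ^ CARD('n)"
    if "z \<in> dcube 0 u" "dcube (-1) v \<subseteq> dcube 0 u" for z :: "real ^ 'n" and u v
  proof (cases "dcube 0 u \<subseteq> dcube k m")
    case True
    with that have "z \<in> dcube k m" "dcube (-1) v \<subseteq> dcube k m" by auto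
    with True show ?thesis
      by (simp add: mean_indicator_subset power_int_minus power_divide)
  next
    case False
    then have "dcube 0 u \<inter> dcube k m = {}" using dcube_nested[OF k] by blast
    with that have "z \<notin> dcube k m" "dcube 0 u \<inter> dcube k m = {}" "dcube (-1) v \<inter> dcube k m = {}" by auto
    then show ?thesis by (simp add: mean_indicator_disjoint)
  qed
  have 1: "(0 :: real ^ 'n) \<in> dcube 0 0" "(\<chi> i. 7 :: real ^ 'n) \<in> dcube 0 (\<chi> i. 7)"
    by (auto simp: mem_dcube)
  note ** = *[OF 1(1) corner_cubes(1)] *[OF 1(2) corner_cubes(2)]
  have "mean (corner_fun p q r s) k m = p * mean (indicator (dcube 0 0)) k m + q * mean (indicator (dcube (-1) 0)) k m
     + r * mean (indicator (dcube 0 (\<chi> i. 7))) k m + s * mean (indicator (dcube (-1) (\<chi> i. 14))) k m"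
    unfolding corner_fun_def[abs_def]
    by (simp only: mean_add mean_cmult set_integral_add set_integrable_mult_right set_integrable_indicator_dcube)
  then show ?thesis
    using ** by (simp add: a_def b_def add_divide_distrib algebra_simps)
qed

text \<open>Every cube in the definition has level at least -1, so a cube of negative level lies
  inside it or outside it. The variance on such a cube is therefore 0.\<close>

lemma corner_fun_constant:
  assumes "k < 0" "x \<in> dcube k m" "y \<in> dcube k m"
  shows "corner_fun p q r s x = corner_fun p q r s y"
proof -
  have "indicator (dcube j u) x = (indicator (dcube j u) y :: real)" if "-1 \<le> j" for j u
  proof -
    have "dcube k m \<subseteq> dcube j u \<or> dcube k m \<inter> dcube j u = {}"
      using assms(1) that by (intro dcube_nested) simp
    then have "x \<in> dcube j u \<longleftrightarrow> y \<in> dcube j u" using assms(2,3) by blast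
    then show ?thesis by (simp add: indicator_def)
  qed
  then show ?thesis by (simp add: corner_fun_def)
qed

lemma locally_integrable_corner_fun: "locally_integrable (corner_fun p q r s)"
proof -
  have "integrable lebesgue (indicator (dcube j u) :: _ \<Rightarrow> real)" for j u
    by (intro integrable_real_indicator) (simp_all add: dcube_sets emeasure_dcube)
  then have "integrable lebesgue (corner_fun p q r s)"
    unfolding corner_fun_def[abs_def]
    by (intro Bochner_Integration.integrable_add integrable_mult_right)
  then show ?thesis
    unfolding locally_integrable_def set_integrable_def
    by (intro allI impI integrable_mult_indicator) (auto dest: compact_imp_closed)
qed

text \<open>With \<open>N = 2^n\<close>, the quotient of \<open>e * Delta 1 J f\<close> by
  \<open>Delta 2 J f\<close> is exactly \<open>sqrt N / (N + 1)\<close>. The factor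
  \<open>8^n\<close> is the volume of the root cube.\<close>

lemma BMOd_extremal:
  fixes e :: real
  assumes e: "e > 0"
  obtains f :: "real ^ 'n::finite \<Rightarrow> real" and J where
    "f \<in> BMOd" "BMOd_norm f = ennreal e" "J \<in> dyadic_cubes"
    "Delta 2 J f = ennreal (2 * e\<^sup>2 * (2 ^ CARD('n) + 1) / 8 ^ CARD('n))"
    "Delta 1 J f = ennreal (2 * e * sqrt (2 ^ CARD('n)) / 8 ^ CARD('n))"
proof -
  define N where "N = (2 ^ CARD('n) :: real)"
  define s where "s = sqrt N"
  define t where "t = sqrt (N - 1)"
  have N: "N \<ge> 2" unfolding N_def using self_le_power[of "2 :: real" "CARD('n)"] by simp
  have s: "s > 0" "s\<^sup>2 = N" and t: "t > 0" "t\<^sup>2 = N - 1" using N by (auto simp: s_def t_def)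
  txt \<open>Chosen so that on a unit cube \<open>\<alpha> 1_C + \<beta> 1_D\<close>, \<open>D\<close> a child of \<open>C\<close>, has mean \<open>s\<close> and variance 1.\<close>
  define \<alpha> where "\<alpha> = s - 1 / t"
  define \<beta> where "\<beta> = N / t"
  \<comment> \<open>This makes \<open>\<alpha>\<close> nonnegative, so the function keeps one sign
    on each corner cube and its absolute value there has mean \<open>s\<close> as well.\<close>
  have "1 \<le> s * t"
  proof -
    have "1 \<le> sqrt (N * (N - 1))" using N mult_mono[of 1 N 1 "N - 1"] by simp
    then show ?thesis by (simp add: s_def t_def real_sqrt_mult)
  qed
  then have \<alpha>0: "\<alpha> \<ge> 0" using t by (simp add: \<alpha>_def field_simps)
  have \<beta>0: "\<beta> \<ge> 0" using t N by (simp add: \<beta>_def)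
  have first: "\<alpha> + \<beta> / N = s" using N by (simp add: \<alpha>_def \<beta>_def)
  \<comment> \<open>The mean square \<open>N + 1\<close> is the squared mean \<open>s^2 = N\<close>
    plus the variance 1.\<close>
  have second: "\<alpha>\<^sup>2 + (2 * \<alpha> * \<beta> + \<beta>\<^sup>2) / N = N + 1"
  proof -
    have "\<beta>\<^sup>2 = N\<^sup>2 / (N - 1)" by (simp add: \<beta>_def power_divide t)
    then have b: "\<beta>\<^sup>2 * (1 / N - 1 / N\<^sup>2) = 1" using N by (simp add: field_simps power2_eq_square)
    have "\<alpha>\<^sup>2 + (2 * \<alpha> * \<beta> + \<beta>\<^sup>2) / N = (\<alpha> + \<beta> / N)\<^sup>2 + \<beta>\<^sup>2 * (1 / N - 1 / N\<^sup>2)"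
      using N by (simp add: field_simps power2_eq_square)
    then show ?thesis by (simp add: first b s)
  qed
  define f :: "real ^ 'n \<Rightarrow> real" where "f = corner_fun (e * \<alpha>) (e * \<beta>) (- (e * \<alpha>)) (- (e * \<beta>))"
  have sq: "locally_L2 f" by (simp add: f_def locally_L2_corner_fun)
  define a where "a k m = (of_bool ((0 :: real ^ 'n) \<in> dcube k m) :: real)" for k m
  define b where "b k m = (of_bool ((\<chi> i. 7 :: real ^ 'n) \<in> dcube k m) :: real)" for k m
  define V where "V k = ((2 powi k) ^ CARD('n) :: real)" for k
  have fs: "e * \<alpha> + e * \<beta> / N = e * s" unfolding first[symmetric] by (simp add: algebra_simps)
  have ss: "(e * \<alpha>)\<^sup>2 + (2 * (e * \<alpha>) * (e * \<beta>) + (e * \<beta>)\<^sup>2) / N = e\<^sup>2 * (N + 1)"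
    unfolding second[symmetric] by (simp add: algebra_simps power2_eq_square add_divide_distrib)
  have m1: "mean f k m = e * s * (a k m - b k m) / V k" if "0 \<le> k" for k m
    unfolding f_def mean_corner_fun[OF that] N_def[symmetric] a_def b_def V_def
    using fs by (simp add: algebra_simps)
  have m2: "mean (\<lambda>x. (f x)\<^sup>2) k m = e\<^sup>2 * (N + 1) * (a k m + b k m) / V k" if "0 \<le> k" for k m
    unfolding f_def corner_fun_square mean_corner_fun[OF that] N_def[symmetric] a_def b_def V_def
    using ss by (simp add: algebra_simps)
  have m3: "mean (\<lambda>x. \<bar>f x\<bar>) k m = e * s * (a k m + b k m) / V k" if "0 \<le> k" for k m
  proof -
    have "(\<lambda>x. \<bar>f x\<bar>) = corner_fun (e * \<alpha>) (e * \<beta>) (e * \<alpha>) (e * \<beta>)"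
      using \<alpha>0 \<beta>0 e by (simp add: f_def fun_eq_iff corner_fun_abs)
    then show ?thesis
      unfolding mean_corner_fun[OF that] N_def[symmetric] a_def b_def V_def
      using fs by (simp add: mean_corner_fun[OF that] N_def[symmetric] algebra_simps)
  qed
  have vf: "var f k m = e\<^sup>2 * ((N + 1) * (a k m + b k m) / V k - N * (a k m - b k m)\<^sup>2 / (V k)\<^sup>2)"
    if "0 \<le> k" for k m
  proof -
    have "var f k m = e\<^sup>2 * (N + 1) * (a k m + b k m) / V k - (e * s * (a k m - b k m) / V k)\<^sup>2"
      by (simp only: var_def m1[OF that] m2[OF that])
    also have "(e * s * (a k m - b k m) / V k)\<^sup>2 = e\<^sup>2 * N * (a k m - b k m)\<^sup>2 / (V k)\<^sup>2"
      by (simp only: power_mult_distrib power_divide s)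
    finally show ?thesis
      by (simp only: right_diff_distrib times_divide_eq_right mult.assoc)
  qed
  have V0: "V k > 0" for k by (simp add: V_def)
  \<comment> \<open>A cube containing both corner points has index 0 in each coordinate, and then
    \<open>7 < 2^k\<close>.\<close>
  have both: "3 \<le> k" if "a k m = 1" "b k m = 1" "0 \<le> k" for k m
  proof (rule ccontr)
    assume "\<not> 3 \<le> k"
    with that have k: "k = 0 \<or> k = 1 \<or> k = 2" by auto
    have "m $ i = 0" "\<lfloor>7 / 2 powi k :: real\<rfloor> = m $ i" for i
      using that by (auto simp: a_def b_def dcube_def)
    from this[of undefined] k show False by (auto simp: floor_eq_iff)
  qed
  have Vpow: "V (int j) = N ^ j" for j
    by (simp add: V_def N_def power_commutes flip: power_mult)
  have var_le: "var f k m \<le> e\<^sup>2" for k m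
  proof (cases "0 \<le> k")
    case False
    obtain y where y: "y \<in> dcube k m" using dcube_nonempty by blast
    have fy: "f x = f y" if "x \<in> dcube k m" for x
      using corner_fun_constant[of k x m y] that y False by (simp add: f_def)
    have "mean f k m = f y" "mean (\<lambda>x. (f x)\<^sup>2) k m = (f y)\<^sup>2"
      using mean_cong[of k m f "\<lambda>x. f y"] mean_cong[of k m "\<lambda>x. (f x)\<^sup>2" "\<lambda>x. (f y)\<^sup>2"] fy by auto
    then show ?thesis by (simp add: var_def)
  next
    case True
    then obtain j where j: "k = int j" using nonneg_int_cases by blast
    have Vj: "V k = N ^ j" by (simp add: j Vpow)
    txt \<open>The variance on a cube containing one corner cube, and on a cube containing both.\<close>
    have one: "(N + 1) / V k - N / (V k)\<^sup>2 \<le> 1"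
    proof -
      \<comment> \<open>The volume \<open>V k\<close> is a power of \<open>N\<close>, and none lies
        strictly between 1 and \<open>N\<close>. Equality for the corner cube and its parent is the
        extremal feature of the example.\<close>
      have "0 \<le> (V k - 1) * (V k - N)"
      proof (cases j)
        case (Suc j')
        have "N * 1 \<le> N * N ^ j'" using N by (intro mult_left_mono one_le_power) auto
        then have "N \<le> V k" by (simp add: Vj Suc)
        then show ?thesis using N by (intro mult_nonneg_nonneg) auto
      qed (simp add: Vj)
      then have "0 \<le> (V k - 1) * (V k - N) / (V k)\<^sup>2" by simp
      also have "\<dots> = 1 - ((N + 1) / V k - N / (V k)\<^sup>2)"
        using V0[of k] by (simp add: divide_simps) (simp add: algebra_simps power2_eq_square)
      finally show ?thesis by simp
    qed
    have two: "(N + 1) * 2 / V k \<le> 1" if "3 \<le> k"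
    proof -
      \<comment> \<open>With both corner cubes inside, the means cancel and the variance is the
        whole mean square; the volume, at least \<open>N^3\<close>, makes it small.\<close>
      have "2 * (N + 1) \<le> 2 * 2 * N" using N by simp
      also have "\<dots> \<le> N * N * N" using N by (intro mult_mono) auto
      also have "\<dots> = N ^ 3" by (simp add: power3_eq_cube)
      also have "\<dots> \<le> V k" using that N unfolding j Vpow by (intro power_increasing) auto
      finally have "2 * (N + 1) \<le> V k" .
      then show ?thesis using V0[of k] by (simp add: field_simps)
    qed
    have "(N + 1) * (a k m + b k m) / V k - N * (a k m - b k m)\<^sup>2 / (V k)\<^sup>2 \<le> 1"
      using one two both[of k m] True by (auto simp: a_def b_def)
    then show ?thesis unfolding vf[OF True] using e by (simp add: mult_le_cancel_left1)
  qed
  \<comment> \<open>The unit corner cube at the origin attains the bound, so the norm is exactly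
    \<open>e\<close>.\<close>
  have "var f 0 0 = e\<^sup>2"
  proof -
    have "a 0 0 = 1" "b 0 0 = 0" by (auto simp: a_def b_def dcube_def)
    then show ?thesis by (simp add: vf V_def)
  qed
  have norm_f: "BMOd_norm f = ennreal e"
  proof (rule antisym)
    show "BMOd_norm f \<le> ennreal e"
      unfolding BMOd_norm_def
    proof (rule SUP_least)
      fix J :: "(real ^ 'n) set" assume "J \<in> dyadic_cubes"
      then obtain k m where "J = obox k m" by (rule dyadicE)
      then show "esqrt (Delta 2 J f) \<le> ennreal e"
        using var_le[of k m] var_nonneg[OF sq, of k m] e
        by (simp add: Delta_obox[OF sq] esqrt_ennreal ennreal_leI real_le_lsqrt)
    qed
    have "ennreal e = esqrt (Delta 2 (obox 0 (0 :: int ^ 'n)) f)"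
      using \<open>var f 0 0 = e\<^sup>2\<close> e by (simp only: Delta_obox[OF sq] esqrt_ennreal) (simp add: esqrt_ennreal)
    also have "\<dots> \<le> BMOd_norm f"
      unfolding BMOd_norm_def by (rule SUP_upper[OF obox_dyadic])
    finally show "ennreal e \<le> BMOd_norm f" .
  qed
  have inBMO: "f \<in> BMOd"
    using norm_f locally_integrable_corner_fun by (simp add: BMOd_def f_def)
  have ab: "a 3 0 = 1" "b 3 0 = 1" by (auto simp: a_def b_def dcube_def)
  have V3: "V 3 = 8 ^ CARD('n)" by (simp add: V_def)
  \<comment> \<open>The opposite corners cancel on the root, so its mean oscillation is the mean of
    \<open>|f|\<close>.\<close>
  have "mean f 3 0 = 0" "var f 3 0 = 2 * e\<^sup>2 * (N + 1) / 8 ^ CARD('n)"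
    "mean (\<lambda>x. \<bar>f x\<bar>) 3 0 = 2 * e * s / 8 ^ CARD('n)"
    by (simp_all add: m1 m3 vf ab V3)
  then have D: "Delta 2 (obox 3 0) f = ennreal (2 * e\<^sup>2 * (N + 1) / 8 ^ CARD('n))"
    "Delta 1 (obox 3 0) f = ennreal (2 * e * s / 8 ^ CARD('n))"
    by (simp_all only: Delta_obox[OF sq] diff_0_right)
  show thesis
    by (rule that[OF inBMO norm_f obox_dyadic[of 3 0]]) (simp_all only: D N_def s_def)
qed

theorem theorem1p7:
  shows "(\<forall>\<phi> \<in> (BMOd :: (real ^ 'n::finite \<Rightarrow> real) set). \<forall>J \<in> dyadic_cubes.
            ennreal (BMO_const TYPE('n)) * Delta 2 J \<phi> \<le> BMOd_norm \<phi> * Delta 1 J \<phi>)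
       \<and> (\<forall>\<epsilon>::real. \<epsilon> > 0 \<longrightarrow>
            (\<forall>C::real. C > BMO_const TYPE('n) \<longrightarrow>
              \<not> (\<forall>\<phi> \<in> (BMOd :: (real ^ 'n \<Rightarrow> real) set). BMOd_norm \<phi> = ennreal \<epsilon> \<longrightarrow>
                   (\<forall>J \<in> dyadic_cubes.
                      ennreal C * Delta 2 J \<phi> \<le> BMOd_norm \<phi> * Delta 1 J \<phi>))))
       \<and> (\<forall>\<phi> \<in> (BMOd :: (real ^ 'n \<Rightarrow> real) set).
            ennreal (BMO_const TYPE('n)) * BMOd_norm \<phi> \<le> BMOd1_norm \<phi>)"
proof (intro conjI ballI allI impI notI)
  fix \<epsilon> C :: real
  assume e: "\<epsilon> > 0" and C: "C > BMO_const TYPE('n)"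
    and all: "\<forall>\<phi> \<in> (BMOd :: (real ^ 'n \<Rightarrow> real) set). BMOd_norm \<phi> = ennreal \<epsilon> \<longrightarrow>
      (\<forall>J \<in> dyadic_cubes. ennreal C * Delta 2 J \<phi> \<le> BMOd_norm \<phi> * Delta 1 J \<phi>)"
  define N where "N = (2 ^ CARD('n) :: real)"
  have N: "N > 0" by (simp add: N_def)
  \<comment> \<open>Since \<open>ennreal\<close> sends negative numbers to 0, positivity of
    \<open>C\<close> is what permits the return to a real inequality.\<close>
  have C0: "C > 0" using C BMO_const_pos[where 'n='n] by simp
  obtain f :: "real ^ 'n \<Rightarrow> real" and J where f: "f \<in> BMOd" "BMOd_norm f = ennreal \<epsilon>" "J \<in> dyadic_cubes"
    and D: "Delta 2 J f = ennreal (2 * \<epsilon>\<^sup>2 * (N + 1) / 8 ^ CARD('n))"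
      "Delta 1 J f = ennreal (2 * \<epsilon> * sqrt N / 8 ^ CARD('n))"
    unfolding N_def using BMOd_extremal[OF e] by blast
  have "ennreal C * Delta 2 J f \<le> BMOd_norm f * Delta 1 J f" using all f by blast
  then have "C * (2 * \<epsilon>\<^sup>2 * (N + 1) / 8 ^ CARD('n)) \<le> \<epsilon> * (2 * \<epsilon> * sqrt N / 8 ^ CARD('n))"
    unfolding f(2) D using e C0 N by (subst (asm) (1 2) ennreal_mult[symmetric]) (auto simp: ennreal_le_iff)
  \<comment> \<open>After the common factor is cancelled, \<open>C * (N + 1) <= sqrt N\<close>
    remains, contrary to the choice of \<open>C\<close>.\<close>
  then have "(2 * \<epsilon>\<^sup>2 / 8 ^ CARD('n)) * (C * (N + 1)) \<le> (2 * \<epsilon>\<^sup>2 / 8 ^ CARD('n)) * sqrt N"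
    by (simp add: power2_eq_square mult_ac)
  then have "C * (N + 1) \<le> sqrt N"
    by (rule mult_left_le_imp_le) (use e in simp)
  moreover have "sqrt N < C * (N + 1)"
    using C N by (simp add: BMO_const_eq N_def[symmetric] pos_divide_less_eq)
  ultimately show False by simp
qed (simp_all add: Delta_two_le_Delta_one BMOd_norm_le_BMOd1_norm)

end
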